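(* Let $r_{1/k,x}$ and $r_{1/k,y}$ be the maximum TT-ranks of the QTT-matrices $K_x^{-1}$ and $K_y^{-1}$ (maximum over $\alpha=1,\dots,2d-1$), let $r_{q,x}$ and $r_{q,y}$ be the maximum TT-ranks of the QTT-vectors $\bm{q}_x$ and $\bm{q}_y$ (maximum over $\alpha=1,\dots,d-1$), and let $r_f$ be the maximum TT-rank of the QTT-vector $\bm{f}$ (maximum over $\alpha=1,\dots,2d-1$). Then: (1) the QTT-matrix $H_x+H_y$ of the linear system $(H_x+H_y)\bm{\mu}=H_y\bm{f}$ has TT-ranks bounded by $$4\left(1+r_{1/k,x}\,r_{q,x}\right)r_{1/k,x}+4\left(1+r_{1/k,y}\,r_{q,y}\right)r_{1/k,y};$$ (2) the right-hand side $H_y\bm{f}$ of this linear system has TT-ranks bounded by $$4\left(1+r_{1/k,y}\,r_{q,y}\right)r_{1/k,y}\,r_f .$$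
   Context: QTT-format. A vector $\bm{x}$ of length $2^m$ is identified with the $m$-dimensional tensor $\mathcal{X}\in\mathbb{R}^{2\times\cdots\times2}$, $\mathcal{X}[i_1,\dots,i_m]=\bm{x}[i]$, $i=i_1+2i_2+\dots+2^{m-1}i_m$, $i_\alpha\in\{0,1\}$. A TT-representation is $\mathcal{X}[i_1,\dots,i_m]=G_1(i_1)G_2(i_2)\cdots G_m(i_m)$ with $G_\alpha(i_\alpha)$ a matrix of size $R_{\alpha-1}\times R_\alpha$, $R_0=R_m=1$. A $2^m\times2^m$ matrix with row index $i=i_1+2i_2+\dots+2^{m-1}i_m$ and column index $j=j_1+2j_2+\dots+2^{m-1}j_m$, where $i_\alpha,j_\alpha\in\{0,1\}$, is identified with the tensor with modes $(i_\alpha,j_\alpha)$, and a TT-representation is $A[i,j]=G_1(i_1,j_1)\cdots G_m(i_m,j_m)$ with $G_\alpha(i_\alpha,j_\alpha)$ of size $R_{\alpha-1}\times R_\alpha$. The TT-ranks $R_1,\dots,R_{m-1}$ are taken to be those of an exact representation with minimal ranks, i.e. $R_\alpha$ is the rank of the unfolding matrix whose rows are indexed by the first $\alpha$ modes and whose columns are indexed by the remaining modes. (A maximum over an empty index set is taken to be $1$.) Matrices. Let $d\in\mathbb{N}$, $n=2^d$, $h=1/n$. Indices start at $0$, and $(A\otimes C)[in+k,\,jn+l]=A[i,j]\,C[k,l]$ for $n\times n$ matrices. $f,k_x,k_y$ are functions on $[0,1]^2$ (right-hand side and diffusion coefficients of $-\nabla\cdot(\mathrm{diag}(k_x,k_y)\nabla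 u)=f$, $u|_{\partial\Omega}=0$). For $\alpha=i+nj$ with $0\le i,j\le n-1$: $$\bm{f}[\alpha]=f\big((i+1)h,(j+1)h\big),\quad \bm{k}_x[\alpha]=k_x\big((i+\tfrac12)h,(j+1)h\big),\quad \bm{k}_y[\alpha]=k_y\big((i+1)h,(j+\tfrac12)h\big),$$ and $K_x=\mathrm{diag}(\bm{k}_x)$, $K_y=\mathrm{diag}(\bm{k}_y)$ ($n^2\times n^2$). $I$ is the $n\times n$ identity, $E$ the $n\times n$ matrix of ones, $B$ the $n\times n$ matrix with $B[i,j]=h$ if $i\ge j$ and $0$ otherwise, $B_x=I\otimes B$, $B_y=B\otimes I$. $Q_x=\mathrm{diag}(\bm{q}_x)$, $Q_y=\mathrm{diag}(\bm{q}_y)$ with $$\bm{q}_x[i]=\Big(\sum_{\alpha=0}^{n-1}\frac{1}{\bm{k}_x[in+\alpha]}\Big)^{-1},\qquad \bm{q}_y[i]=\Big(\sum_{\alpha=0}^{n-1}\frac{1}{\bm{k}_y[i+n\alpha]}\Big)^{-1},\qquad i=0,\dots,n-1,$$ where all entries of $\bm{k}_x,\bm{k}_y$ and all these sums are assumed nonzero (as holds for positive coefficients). Finally $$H_x=B_xK_x^{-1}\left(I\otimes I-(Q_x\otimes E)K_x^{-1}\right)B_x^T,\qquad H_y=B_yK_y^{-1}\left(I\otimes I-(E\otimes Q_y)K_y^{-1}\right)B_y^T.$$ *)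

theory Defs
  imports Complex_Main "Jordan_Normal_Form.Gauss_Jordan_Elimination" "Jordan_Normal_Form.DL_Rank"
begin

section \<open>Matrices\<close>

abbreviation mat_rank :: "real mat \<Rightarrow> nat" where
  "mat_rank A \<equiv> vec_space.rank (dim_row A) A"

definition mat_inv :: "real mat \<Rightarrow> real mat" where
  "mat_inv A = the (mat_inverse A)"

definition diag_of_vec :: "real vec \<Rightarrow> real mat" where
  "diag_of_vec v = mat_diag (dim_vec v) (\<lambda>i. v $ i)"

definition kron :: "real mat \<Rightarrow> real mat \<Rightarrow> real mat" where
  "kron A C = mat (dim_row A * dim_row C) (dim_col A * dim_col C)
     (\<lambda>(r, s). A $$ (r div dim_row C, s div dim_col C) * C $$ (r mod dim_row C, s mod dim_col C))"

section \<open>QTT-ranks\<close>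

text \<open>
  An index \<open>i < 2 ^ m\<close> has the little-endian binary digits \<open>i\<^sub>1, \<dots>, i\<^sub>m\<close>, so \<open>i = a + 2 ^ \<alpha> * b\<close>, where
  \<open>a\<close> collects the first \<open>\<alpha>\<close> digits and \<open>b\<close> the remaining ones.  The \<open>\<alpha>\<close>-th TT-rank
  of a vector of length \<open>2 ^ m\<close> is the rank of its \<open>\<alpha>\<close>-th unfolding.
\<close>

definition vec_unfolding :: "nat \<Rightarrow> real vec \<Rightarrow> nat \<Rightarrow> real mat" where
  "vec_unfolding m x \<alpha> = mat (2 ^ \<alpha>) (2 ^ (m - \<alpha>)) (\<lambda>(a, b). x $ (a + 2 ^ \<alpha> * b))"

definition vec_tt_rank :: "nat \<Rightarrow> real vec \<Rightarrow> nat \<Rightarrow> nat" where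
  "vec_tt_rank m x \<alpha> = mat_rank (vec_unfolding m x \<alpha>)"

text \<open>
  For a \<open>2 ^ m \<times> 2 ^ m\<close> matrix the modes are the pairs \<open>(i\<^sub>\<beta>, j\<^sub>\<beta>)\<close>.  The row
  \<open>p < 4 ^ \<alpha>\<close> of the unfolding stands for the first \<open>\<alpha>\<close> modes, encoded as
  \<open>p = a + 2 ^ \<alpha> * a'\<close> with \<open>a\<close>, \<open>a'\<close> the first \<open>\<alpha>\<close> digits of the row and column index;
  likewise its column \<open>q = b + 2 ^ (m - \<alpha>) * b'\<close> stands for the remaining modes.
\<close>

definition mat_unfolding :: "nat \<Rightarrow> real mat \<Rightarrow> nat \<Rightarrow> real mat" where
  "mat_unfolding m A \<alpha> = mat (4 ^ \<alpha>) (4 ^ (m - \<alpha>))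
     (\<lambda>(p, q). A $$ (p mod 2 ^ \<alpha> + 2 ^ \<alpha> * (q mod 2 ^ (m - \<alpha>)),
                     p div 2 ^ \<alpha> + 2 ^ \<alpha> * (q div 2 ^ (m - \<alpha>))))"

definition mat_tt_rank :: "nat \<Rightarrow> real mat \<Rightarrow> nat \<Rightarrow> nat" where
  "mat_tt_rank m A \<alpha> = mat_rank (mat_unfolding m A \<alpha>)"

text \<open>The maximum of the TT-ranks \<open>r \<alpha>\<close> over \<open>1 \<le> \<alpha> \<le> m - 1\<close>, taken to be 1 if this range is empty.\<close>

definition max_tt_rank :: "nat \<Rightarrow> (nat \<Rightarrow> nat) \<Rightarrow> nat" where
  "max_tt_rank m r = (if m \<le> 1 then 1 else Max (r ` {1..<m}))"

section \<open>The discretized problem\<close>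

text \<open>
  The entry \<open>\<alpha> = i + n * j\<close>, \<open>i, j < n\<close>, of the grid vectors of length \<open>n * n\<close> has
  \<open>i = \<alpha> mod n\<close> and \<open>j = \<alpha> div n\<close>; the mesh width is \<open>h = 1 / n\<close>.
\<close>

definition f_vec :: "nat \<Rightarrow> (real \<Rightarrow> real \<Rightarrow> real) \<Rightarrow> real vec" where
  "f_vec n f = vec (n * n)
     (\<lambda>\<alpha>. f ((real (\<alpha> mod n) + 1) * (1 / real n)) ((real (\<alpha> div n) + 1) * (1 / real n)))"

definition kx_vec :: "nat \<Rightarrow> (real \<Rightarrow> real \<Rightarrow> real) \<Rightarrow> real vec" where
  "kx_vec n kx = vec (n * n)
     (\<lambda>\<alpha>. kx ((real (\<alpha> mod n) + 1 / 2) * (1 / real n)) ((real (\<alpha> div n) + 1) * (1 / real n)))"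

definition ky_vec :: "nat \<Rightarrow> (real \<Rightarrow> real \<Rightarrow> real) \<Rightarrow> real vec" where
  "ky_vec n ky = vec (n * n)
     (\<lambda>\<alpha>. ky ((real (\<alpha> mod n) + 1) * (1 / real n)) ((real (\<alpha> div n) + 1 / 2) * (1 / real n)))"

definition qx_vec :: "nat \<Rightarrow> real vec \<Rightarrow> real vec" where
  "qx_vec n k = vec n (\<lambda>i. inverse (\<Sum>\<alpha><n. 1 / k $ (i * n + \<alpha>)))"

definition qy_vec :: "nat \<Rightarrow> real vec \<Rightarrow> real vec" where
  "qy_vec n k = vec n (\<lambda>i. inverse (\<Sum>\<alpha><n. 1 / k $ (i + n * \<alpha>)))"

definition E_mat :: "nat \<Rightarrow> real mat" where
  "E_mat n = mat n n (\<lambda>_. 1)"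

definition B_mat :: "nat \<Rightarrow> real mat" where
  "B_mat n = mat n n (\<lambda>(i, j). if i \<ge> j then 1 / real n else 0)"

definition Bx_mat :: "nat \<Rightarrow> real mat" where
  "Bx_mat n = kron (1\<^sub>m n) (B_mat n)"

definition By_mat :: "nat \<Rightarrow> real mat" where
  "By_mat n = kron (B_mat n) (1\<^sub>m n)"

definition Hx_mat :: "nat \<Rightarrow> real vec \<Rightarrow> real mat" where
  "Hx_mat n k = Bx_mat n * mat_inv (diag_of_vec k)
     * (kron (1\<^sub>m n) (1\<^sub>m n) - kron (diag_of_vec (qx_vec n k)) (E_mat n) * mat_inv (diag_of_vec k))
     * transpose_mat (Bx_mat n)"

definition Hy_mat :: "nat \<Rightarrow> real vec \<Rightarrow> real mat" where
  "Hy_mat n k = By_mat n * mat_inv (diag_of_vec k)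
     * (kron (1\<^sub>m n) (1\<^sub>m n) - kron (E_mat n) (diag_of_vec (qy_vec n k)) * mat_inv (diag_of_vec k))
     * transpose_mat (By_mat n)"

end

theory Submission
  imports Defs
begin

text \<open>
  A TT-rank is the minimal number of terms in a decomposition of a matrix into Kronecker products
  \<open>\<Sum>k<r. Q k \<otimes> P k\<close>.  Such decompositions add under sums and multiply under matrix
  products, and a vector is a matrix with a single column.  Both \<open>B\<close> and its transpose need two
  terms at every cut, the identity and \<open>E\<close> one, and a diagonal matrix as many as the vector on its
  diagonal.  Since a cut of \<open>C \<otimes> A\<close> is a cut of one of the two factors, multiplying these
  numbers along the definitions of \<open>H\<^sub>x\<close> and \<open>H\<^sub>y\<close> gives the bounds; at the
  cuts of \<open>E\<close> the single term is absorbed by the rank of the nonzero vector \<open>q\<close>, which is at least 1.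
\<close>

section \<open>Rank factorizations\<close>

text \<open>Each term is an outer product, hence of rank at most 1, and rank is subadditive.\<close>

lemma (in vec_space) rank_sum_products_le:
  fixes F G :: "nat \<Rightarrow> nat \<Rightarrow> 'a"
  shows "rank (mat n nc (\<lambda>(i, j). \<Sum>k<r. F k i * G k j)) \<le> r"
proof (induction r)
  case 0
  have "mat n nc (\<lambda>(i, j). \<Sum>k<0::nat. F k i * G k j) = 0\<^sub>m n nc"
    by (intro eq_matI) auto
  then show ?case by (simp only: rank_0I le_refl)
next
  case (Suc r)
  let ?A = "mat n nc (\<lambda>(i, j). \<Sum>k<r. F k i * G k j)"
  let ?B = "mat n nc (\<lambda>(i, j). F r i * G r j)"
  have "rank (?A + ?B) \<le> rank ?A + rank ?B"
    by (rule rank_subadditive) auto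
  moreover have "rank ?B \<le> 1"
    by (rule rank_le_1_product_entries[of _ nc "F r" "G r"]) auto
  moreover have "mat n nc (\<lambda>(i, j). \<Sum>k<Suc r. F k i * G k j) = ?A + ?B"
    by (intro eq_matI) auto
  ultimately show ?case using Suc by simp
qed

text \<open>A maximal independent set of columns has \<open>rank A\<close> elements and spans every
  column; its vectors supply \<open>F\<close> and the coefficients supply \<open>G\<close>.\<close>

lemma (in vec_space) rank_factorization:
  assumes A: "A \<in> carrier_mat n nc"
  shows "\<exists>F G. \<forall>i<n. \<forall>j<nc. A $$ (i, j) = (\<Sum>k<rank A. F k i * G k j)"
proof -
  let ?C = "set (cols A)"
  have C: "?C \<subseteq> carrier_vec n" using cols_dim A by blast
  \<comment> \<open>The empty set starts the search for a maximal independent set of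
    columns.\<close>
  have "lin_indpt {}"
    by (metis empty_subsetI fin_dim finite_basis_exists subset_li_is_li vec_vs vectorspace.basis_def)
  then obtain S where max: "maximal S (\<lambda>T. T \<subseteq> ?C \<and> lin_indpt T)" and fin: "finite S"
    using maximal_exists_superset[of ?C "\<lambda>T. T \<subseteq> ?C \<and> lin_indpt T" "{}"] by auto
  have S: "S \<subseteq> ?C" "lin_indpt S" using max unfolding maximal_def by auto
  have card: "rank A = card S" using rank_card_indpt[OF A max] .
  have Sc: "S \<subseteq> carrier_vec n" using S(1) C by blast
  have "\<exists>g. c = lincomb g S" if c: "c \<in> ?C" for c
  proof -
    \<comment> \<open>A column outside the span could join \<open>S\<close> without losing
      independence, against maximality.\<close>
    have "c \<in> span S"
    proof (rule ccontr)
      assume notin: "c \<notin> span S"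
      have cV: "c \<in> carrier_vec n" using c C by auto
      have cS: "c \<notin> S" using notin span_mem[OF Sc] by metis
      have "lin_indpt (S \<union> {c})"
        using lin_dep_iff_in_span[OF Sc S(2) cV cS] notin by metis
      moreover have "S \<union> {c} \<subseteq> ?C" using c S(1) by simp
      ultimately have "S \<union> {c} = S" using max unfolding maximal_def by (metis Un_upper1)
      with cS show False by (metis UnI2 singletonI)
    qed
    then show ?thesis unfolding finite_span[OF fin Sc] by force
  qed
  then obtain g where g: "\<And>c. c \<in> ?C \<Longrightarrow> c = lincomb (g c) S" by metis
  \<comment> \<open>Numbering the elements of \<open>S\<close> turns the linear combination into a
    sum over \<open>k < rank A\<close>.\<close>
  obtain e where e: "bij_betw e {..<card S} S"
    using ex_bij_betw_nat_finite[OF fin] by (auto simp: atLeast0LessThan)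
  show ?thesis
  proof (rule exI[of _ "\<lambda>k i. e k $ i"], rule exI[of _ "\<lambda>k j. g (col A j) (e k)"], intro allI impI)
    fix i j assume ij: "i < n" "j < nc"
    have cj: "col A j \<in> ?C" using A ij by (simp add: cols_def)
    have "A $$ (i, j) = col A j $ i" using A ij by auto
    also have "\<dots> = lincomb (g (col A j)) S $ i" using g[OF cj] by simp
    also have "\<dots> = (\<Sum>x\<in>S. g (col A j) x * x $ i)"
      using lincomb_index[OF ij(1) Sc] .
    also have "\<dots> = (\<Sum>k<card S. g (col A j) (e k) * e k $ i)"
      by (rule sum.reindex_bij_betw[OF e, symmetric])
    finally show "A $$ (i, j) = (\<Sum>k<rank A. e k $ i * g (col A j) (e k))"
      by (simp only: card mult.commute)
  qed
qed

section \<open>Sums of Kronecker products\<close>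

text \<open>\<open>P k\<close> is the low Kronecker factor, of size \<open>N\<close> by
  \<open>N'\<close>, and \<open>Q k\<close> the high one, of size \<open>M\<close> by
  \<open>M'\<close>. Both are plain functions of indices, so only the size of \<open>A\<close> has
  to be tracked. Separate row and column sizes let matrices and single columns share one
  calculus.\<close>

definition kron_rank_le :: "nat \<Rightarrow> nat \<Rightarrow> nat \<Rightarrow> nat \<Rightarrow> nat \<Rightarrow> real mat \<Rightarrow> bool" where
  "kron_rank_le r N N' M M' A \<longleftrightarrow> A \<in> carrier_mat (N * M) (N' * M') \<and>
     (\<exists>P Q. \<forall>i<N * M. \<forall>j<N' * M'.
        A $$ (i, j) = (\<Sum>k<r. P k (i mod N) (j mod N') * Q k (i div N) (j div N')))"

lemma kron_rank_leI:
  assumes "A \<in> carrier_mat (N * M) (N' * M')"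
    and "\<And>i j. i < N * M \<Longrightarrow> j < N' * M' \<Longrightarrow>
      A $$ (i, j) = (\<Sum>k<r. P k (i mod N) (j mod N') * Q k (i div N) (j div N'))"
  shows "kron_rank_le r N N' M M' A"
  using assms unfolding kron_rank_le_def by blast

lemma kron_rank_leE:
  assumes "kron_rank_le r N N' M M' A"
  obtains P Q where "A \<in> carrier_mat (N * M) (N' * M')"
    and "\<And>i j. i < N * M \<Longrightarrow> j < N' * M' \<Longrightarrow>
      A $$ (i, j) = (\<Sum>k<r. P k (i mod N) (j mod N') * Q k (i div N) (j div N'))"
  using assms unfolding kron_rank_le_def by blast

lemma add_mult_less_mult:
  fixes i j m l :: nat
  assumes "i < m" "j < l"
  shows "i + m * j < m * l"
proof -
  have "i + m * j < m * Suc j" using assms(1) by simp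
  also have "\<dots> \<le> m * l" using assms(2) by (intro mult_le_mono2) simp
  finally show ?thesis .
qed

text \<open>Mixed-radix digits identify \<open>k < m * l\<close> with pairs. This splits the
  contracted index of a matrix product into two blocks, and it also numbers pairs of terms by one
  index.\<close>

lemma sum_lessThan_mult:
  fixes g :: "nat \<Rightarrow> nat \<Rightarrow> 'a::comm_monoid_add"
  shows "(\<Sum>k<m * l. g (k mod m) (k div m)) = (\<Sum>i<m. \<Sum>j<l. g i j)"
proof -
  have "(\<Sum>k<m * l. g (k mod m) (k div m)) = (\<Sum>(i, j)\<in>{..<m} \<times> {..<l}. g i j)"
  proof (cases "m = 0")
    case False
    show ?thesis
      by (rule sum.reindex_bij_witness[of _ "\<lambda>(i, j). i + m * j" "\<lambda>k. (k mod m, k div m)"])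
        (use False in \<open>auto simp: less_mult_imp_div_less[of _ l m] mult.commute[of m l]
            add_mult_less_mult[of _ m _ l, unfolded mult.commute[of m l]]\<close>)
  qed simp
  then show ?thesis by (simp add: sum.cartesian_product)
qed

section \<open>Closure of Kronecker decompositions under matrix operations\<close>

lemma kron_rank_le_mono:
  assumes "kron_rank_le r N N' M M' A" "r \<le> s"
  shows "kron_rank_le s N N' M M' A"
proof -
  obtain P Q where A: "A \<in> carrier_mat (N * M) (N' * M')"
    "\<And>i j. i < N * M \<Longrightarrow> j < N' * M' \<Longrightarrow>
      A $$ (i, j) = (\<Sum>k<r. P k (i mod N) (j mod N') * Q k (i div N) (j div N'))"
    using assms(1) by (rule kron_rank_leE) blast
  \<comment> \<open>The extra terms from \<open>r\<close> to \<open>s - 1\<close> get a zero low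
    factor.\<close>
  have eq: "(\<Sum>k<s. (if k < r then P k a a' else 0) * Q k b b') = (\<Sum>k<r. P k a a' * Q k b b')"
    for a a' b b'
    by (rule sum.mono_neutral_cong_right) (use assms(2) in auto)
  show ?thesis
    by (rule kron_rank_leI[where P = "\<lambda>k a a'. if k < r then P k a a' else 0" and Q = Q])
      (simp_all only: A eq)
qed

lemma kron_rank_le_add:
  assumes "kron_rank_le r N N' M M' A" "kron_rank_le s N N' M M' B"
  shows "kron_rank_le (r + s) N N' M M' (A + B)"
proof -
  obtain P Q where A: "A \<in> carrier_mat (N * M) (N' * M')"
    "\<And>i j. i < N * M \<Longrightarrow> j < N' * M' \<Longrightarrow>
      A $$ (i, j) = (\<Sum>k<r. P k (i mod N) (j mod N') * Q k (i div N) (j div N'))"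
    using assms(1) by (rule kron_rank_leE) blast
  obtain P' Q' where B: "B \<in> carrier_mat (N * M) (N' * M')"
    "\<And>i j. i < N * M \<Longrightarrow> j < N' * M' \<Longrightarrow>
      B $$ (i, j) = (\<Sum>k<s. P' k (i mod N) (j mod N') * Q' k (i div N) (j div N'))"
    using assms(2) by (rule kron_rank_leE) blast
  \<comment> \<open>The two lists of terms are concatenated, the second one shifted by
    \<open>r\<close>.\<close>
  let ?P = "\<lambda>k. if k < r then P k else P' (k - r)" and ?Q = "\<lambda>k. if k < r then Q k else Q' (k - r)"
  have split: "(\<Sum>k<r + s. ?P k a a' * ?Q k b b')
      = (\<Sum>k<r. P k a a' * Q k b b') + (\<Sum>k<s. P' k a a' * Q' k b b')" for a a' b b'
    by (induction s) simp_all
  show ?thesis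
    by (rule kron_rank_leI[where P = ?P and Q = ?Q])
      (use A B in \<open>auto simp only: split index_add_mat carrier_matD add_carrier_mat\<close>)
qed

lemma kron_rank_le_uminus:
  assumes "kron_rank_le r N N' M M' A"
  shows "kron_rank_le r N N' M M' (- A)"
proof -
  obtain P Q where A: "A \<in> carrier_mat (N * M) (N' * M')"
    "\<And>i j. i < N * M \<Longrightarrow> j < N' * M' \<Longrightarrow>
      A $$ (i, j) = (\<Sum>k<r. P k (i mod N) (j mod N') * Q k (i div N) (j div N'))"
    using assms(1) by (rule kron_rank_leE) blast
  show ?thesis
    by (rule kron_rank_leI[where P = "\<lambda>k a a'. - P k a a'" and Q = Q])
      (use A in \<open>simp_all add: sum_negf\<close>)
qed

lemma kron_rank_le_minus:
  assumes "kron_rank_le r N N' M M' A" "kron_rank_le s N N' M M' B"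
  shows "kron_rank_le (r + s) N N' M M' (A - B)"
proof -
  have "A \<in> carrier_mat (N * M) (N' * M')" "B \<in> carrier_mat (N * M) (N' * M')"
    using assms by (auto simp: kron_rank_le_def)
  then have "A - B = A + - B" by (rule minus_add_uminus_mat)
  then show ?thesis using assms kron_rank_le_add kron_rank_le_uminus by metis
qed

lemma kron_rank_le_transpose:
  assumes "kron_rank_le r N N' M M' A"
  shows "kron_rank_le r N' N M' M (transpose_mat A)"
proof -
  obtain P Q where A: "A \<in> carrier_mat (N * M) (N' * M')"
    "\<And>i j. i < N * M \<Longrightarrow> j < N' * M' \<Longrightarrow>
      A $$ (i, j) = (\<Sum>k<r. P k (i mod N) (j mod N') * Q k (i div N) (j div N'))"
    using assms(1) by (rule kron_rank_leE) blast
  show ?thesis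
    by (rule kron_rank_leI[where P = "\<lambda>k a a'. P k a' a" and Q = "\<lambda>k b b'. Q k b' b"])
      (use A in simp_all)
qed

text \<open>The mixed-product property \<open>(Q \<otimes> P) (Q' \<otimes> P') = Q Q' \<otimes> P P'\<close>, summed over all pairs of terms.\<close>

lemma kron_rank_le_mult:
  assumes "kron_rank_le r N N' M M' A" "kron_rank_le s N' N'' M' M'' B"
  shows "kron_rank_le (r * s) N N'' M M'' (A * B)"
proof -
  obtain P Q where A: "A \<in> carrier_mat (N * M) (N' * M')"
    "\<And>i j. i < N * M \<Longrightarrow> j < N' * M' \<Longrightarrow>
      A $$ (i, j) = (\<Sum>k<r. P k (i mod N) (j mod N') * Q k (i div N) (j div N'))"
    using assms(1) by (rule kron_rank_leE) blast
  obtain P' Q' where B: "B \<in> carrier_mat (N' * M') (N'' * M'')"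
    "\<And>i j. i < N' * M' \<Longrightarrow> j < N'' * M'' \<Longrightarrow>
      B $$ (i, j) = (\<Sum>k<s. P' k (i mod N') (j mod N'') * Q' k (i div N') (j div N''))"
    using assms(2) by (rule kron_rank_leE) blast
  \<comment> \<open>The term \<open>k < r * s\<close> stands for the pair of terms
    \<open>k mod r\<close> and \<open>k div r\<close>.\<close>
  define P'' where "P'' k a c = (\<Sum>u<N'. P (k mod r) a u * P' (k div r) u c)" for k a c
  define Q'' where "Q'' k b e = (\<Sum>v<M'. Q (k mod r) b v * Q' (k div r) v e)" for k b e
  have product: "(\<Sum>x<N' * M'. (\<Sum>k<r. P k a (x mod N') * Q k b (x div N'))
          * (\<Sum>l<s. P' l (x mod N') c * Q' l (x div N') e))
      = (\<Sum>k<r * s. P'' k a c * Q'' k b e)" for a b c e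
  proof -
    have "(\<Sum>x<N' * M'. (\<Sum>k<r. P k a (x mod N') * Q k b (x div N'))
          * (\<Sum>l<s. P' l (x mod N') c * Q' l (x div N') e))
      = (\<Sum>u<N'. \<Sum>v<M'. \<Sum>k<r. \<Sum>l<s. P k a u * P' l u c * (Q k b v * Q' l v e))"
      by (subst sum_lessThan_mult) (simp only: sum_product, simp only: mult_ac)
    \<comment> \<open>The exchanges move the term indices \<open>k\<close> and \<open>l\<close>
      outside; the sum over \<open>u\<close> and \<open>v\<close> then splits into a low and a high
      matrix product.\<close>
    also have "\<dots> = (\<Sum>u<N'. \<Sum>k<r. \<Sum>v<M'. \<Sum>l<s. P k a u * P' l u c * (Q k b v * Q' l v e))"
      by (intro sum.cong refl sum.swap)
    also have "\<dots> = (\<Sum>u<N'. \<Sum>k<r. \<Sum>l<s. \<Sum>v<M'. P k a u * P' l u c * (Q k b v * Q' l v e))"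
      by (intro sum.cong refl sum.swap)
    also have "\<dots> = (\<Sum>k<r. \<Sum>u<N'. \<Sum>l<s. \<Sum>v<M'. P k a u * P' l u c * (Q k b v * Q' l v e))"
      by (rule sum.swap)
    also have "\<dots> = (\<Sum>k<r. \<Sum>l<s. \<Sum>u<N'. \<Sum>v<M'. P k a u * P' l u c * (Q k b v * Q' l v e))"
      by (intro sum.cong refl sum.swap)
    also have "\<dots> = (\<Sum>k<r. \<Sum>l<s. (\<Sum>u<N'. P k a u * P' l u c) * (\<Sum>v<M'. Q k b v * Q' l v e))"
      by (simp add: sum_product)
    also have "\<dots> = (\<Sum>k<r * s. P'' k a c * Q'' k b e)"
      unfolding P''_def Q''_def by (rule sum_lessThan_mult[symmetric])
    finally show ?thesis .
  qed
  show ?thesis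
  proof (rule kron_rank_leI[where P = P'' and Q = Q''])
    fix i j assume ij: "i < N * M" "j < N'' * M''"
    have "(A * B) $$ (i, j) = (\<Sum>x<N' * M'. A $$ (i, x) * B $$ (x, j))"
      using A(1) B(1) ij by (simp add: scalar_prod_def atLeast0LessThan)
    also have "\<dots> = (\<Sum>k<r * s. P'' k (i mod N) (j mod N'') * Q'' k (i div N) (j div N''))"
      unfolding product[symmetric] by (intro sum.cong refl) (simp add: A B ij)
    finally show "(A * B) $$ (i, j)
      = (\<Sum>k<r * s. P'' k (i mod N) (j mod N'') * Q'' k (i div N) (j div N''))" .
  qed (use A(1) B(1) in simp)
qed

section \<open>Kronecker products cut inside one factor\<close>

lemma mod_mult_mod: "i mod (m * l) mod m = (i mod m :: nat)"
  by (simp add: mod_mult2_eq)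

lemma mod_mult_div: "0 < m \<Longrightarrow> i mod (m * l) div m = (i div m mod l :: nat)"
  by (simp add: mod_mult2_eq)

text \<open>The cut runs through the low factor \<open>A\<close>, so all of \<open>C\<close> goes
  into each high factor and the number of terms stays the same.\<close>

lemma kron_rank_le_kron_low:
  assumes "kron_rank_le r N N' K K' A" "C \<in> carrier_mat M M'"
  shows "kron_rank_le r N N' (K * M) (K' * M') (kron C A)"
proof -
  obtain P Q where A: "A \<in> carrier_mat (N * K) (N' * K')"
    "\<And>i j. i < N * K \<Longrightarrow> j < N' * K' \<Longrightarrow>
      A $$ (i, j) = (\<Sum>k<r. P k (i mod N) (j mod N') * Q k (i div N) (j div N'))"
    using assms(1) by (rule kron_rank_leE) blast
  show ?thesis
  proof (rule kron_rank_leI[where P = P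
        and Q = "\<lambda>k b b'. C $$ (b div K, b' div K') * Q k (b mod K) (b' mod K')"])
    fix i j assume ij: "i < N * (K * M)" "j < N' * (K' * M')"
    \<comment> \<open>Since an index exists, no size vanishes and the divisions are genuine.\<close>
    then have pos: "0 < N * K" "0 < N' * K'" by (auto intro: Nat.gr0I)
    have "kron C A $$ (i, j) = C $$ (i div (N * K), j div (N' * K')) * A $$ (i mod (N * K), j mod (N' * K'))"
      using ij A(1) assms(2) by (simp add: kron_def ac_simps)
    also have "A $$ (i mod (N * K), j mod (N' * K'))
        = (\<Sum>k<r. P k (i mod N) (j mod N') * Q k (i div N mod K) (j div N' mod K'))"
      using pos by (subst A(2)) (simp_all add: mod_mult_mod mod_mult_div)
    finally show "kron C A $$ (i, j) = (\<Sum>k<r. P k (i mod N) (j mod N')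
        * (C $$ (i div N div K, j div N' div K') * Q k (i div N mod K) (j div N' mod K')))"
      by (simp only: div_mult2_eq sum_distrib_left mult.left_commute)
  qed (use A(1) assms(2) in \<open>auto simp: kron_def ac_simps\<close>)
qed

text \<open>Here the cut runs through the high factor \<open>C\<close>, and \<open>A\<close> joins
  each low factor.\<close>

lemma kron_rank_le_kron_high:
  assumes "kron_rank_le r K K' M M' C" "A \<in> carrier_mat N N'"
  shows "kron_rank_le r (N * K) (N' * K') M M' (kron C A)"
proof -
  obtain P Q where C: "C \<in> carrier_mat (K * M) (K' * M')"
    "\<And>i j. i < K * M \<Longrightarrow> j < K' * M' \<Longrightarrow>
      C $$ (i, j) = (\<Sum>k<r. P k (i mod K) (j mod K') * Q k (i div K) (j div K'))"
    using assms(1) by (rule kron_rank_leE) blast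
  show ?thesis
  proof (rule kron_rank_leI[where Q = Q
        and P = "\<lambda>k a a'. A $$ (a mod N, a' mod N') * P k (a div N) (a' div N')"])
    fix i j assume ij: "i < N * K * M" "j < N' * K' * M'"
    then have pos: "0 < N" "0 < N'" by (auto intro: Nat.gr0I)
    have lt: "i div N < K * M" "j div N' < K' * M'"
      using ij by (auto intro!: less_mult_imp_div_less simp: ac_simps)
    have "kron C A $$ (i, j) = A $$ (i mod N, j mod N') * C $$ (i div N, j div N')"
      using ij C(1) assms(2) by (simp add: kron_def ac_simps)
    also have "C $$ (i div N, j div N')
        = (\<Sum>k<r. P k (i div N mod K) (j div N' mod K') * Q k (i div (N * K)) (j div (N' * K')))"
      using lt by (simp add: C(2) div_mult2_eq)
    finally show "kron C A $$ (i, j) = (\<Sum>k<r. A $$ (i mod (N * K) mod N, j mod (N' * K') mod N')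
        * P k (i mod (N * K) div N) (j mod (N' * K') div N') * Q k (i div (N * K)) (j div (N' * K')))"
      using pos by (simp only: mod_mult_mod mod_mult_div sum_distrib_left mult.assoc)
  qed (use C(1) assms(2) in \<open>auto simp: kron_def ac_simps\<close>)
qed

section \<open>TT-ranks\<close>

lemma mod_div_add_mult:
  fixes a b N :: nat
  assumes "a < N"
  shows "(a + N * b) mod N = a" "(a + N * b) div N = b"
  using assms by auto

text \<open>The unfolding is the rearrangement that sends \<open>Q \<otimes> P\<close> to the outer
  product of the vectorized \<open>P\<close> and \<open>Q\<close>, so Kronecker terms of
  \<open>A\<close> correspond to rank-one terms of the unfolding.\<close>

lemma mat_rank_unfolding_le_iff:
  assumes A: "A \<in> carrier_mat (N * M) (N' * M')"
  shows "mat_rank (mat (N * N') (M * M')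
      (\<lambda>(p, q). A $$ (p mod N + N * (q mod M), p div N + N' * (q div M)))) \<le> r
    \<longleftrightarrow> kron_rank_le r N N' M M' A" (is "mat_rank ?U \<le> r \<longleftrightarrow> _")
proof
  define s where "s = vec_space.rank (N * N') ?U"
  have s: "mat_rank ?U = s" by (simp only: s_def dim_row_mat)
  have "?U \<in> carrier_mat (N * N') (M * M')" by simp
  from vec_space.rank_factorization[OF this, folded s_def] obtain F G where FG:
    "\<And>p q. p < N * N' \<Longrightarrow> q < M * M' \<Longrightarrow> ?U $$ (p, q) = (\<Sum>k<s. F k p * G k q)"
    by blast
  assume "mat_rank ?U \<le> r"
  \<comment> \<open>The factorization yields \<open>s\<close> terms, \<open>s\<close> being the rank
    itself; \<open>r\<close> is reached by padding.\<close>
  have "kron_rank_le s N N' M M' A"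
  proof (rule kron_rank_leI[where P = "\<lambda>k a a'. F k (a + N * a')"
        and Q = "\<lambda>k b b'. G k (b + M * b')", OF A])
    fix i j assume ij: "i < N * M" "j < N' * M'"
    then have pos: "0 < N" "0 < N'" by (auto intro: Nat.gr0I)
    let ?p = "i mod N + N * (j mod N')" and ?q = "i div N + M * (j div N')"
    have lt: "i div N < M" "j div N' < M'"
      using ij by (auto intro: less_mult_imp_div_less simp: mult.commute)
    have pq: "?p < N * N'" "?q < M * M'"
      using pos lt by (auto intro: add_mult_less_mult)
    have "A $$ (i, j) = ?U $$ (?p, ?q)"
      using pq pos lt by (simp add: mod_div_add_mult)
    also have "\<dots> = (\<Sum>k<s. F k ?p * G k ?q)" using pq by (rule FG)
    finally show "A $$ (i, j) = (\<Sum>k<s. F k ?p * G k ?q)" .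
  qed
  then show "kron_rank_le r N N' M M' A"
    using \<open>mat_rank ?U \<le> r\<close> unfolding s by (rule kron_rank_le_mono)
next
  assume "kron_rank_le r N N' M M' A"
  then obtain P Q where PQ: "\<And>i j. i < N * M \<Longrightarrow> j < N' * M' \<Longrightarrow>
      A $$ (i, j) = (\<Sum>k<r. P k (i mod N) (j mod N') * Q k (i div N) (j div N'))"
    by (rule kron_rank_leE) blast
  have U: "?U = mat (N * N') (M * M')
      (\<lambda>(p, q). \<Sum>k<r. P k (p mod N) (p div N) * Q k (q mod M) (q div M))"
  proof (rule eq_matI, goal_cases)
    case (1 p q)
    then have pq: "p < N * N'" "q < M * M'" by auto
    then have pos: "0 < N" "0 < M" by (auto intro: Nat.gr0I)
    have lt: "p div N < N'" "q div M < M'"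
      using pq by (auto intro: less_mult_imp_div_less simp: mult.commute)
    have "p mod N + N * (q mod M) < N * M" "p div N + N' * (q div M) < N' * M'"
      using pos lt by (auto intro: add_mult_less_mult)
    then show ?case using pq pos lt by (simp add: PQ mod_div_add_mult)
  qed auto
  show "mat_rank ?U \<le> r"
    unfolding U dim_row_mat
    by (rule vec_space.rank_sum_products_le[where F = "\<lambda>k p. P k (p mod N) (p div N)"
        and G = "\<lambda>k q. Q k (q mod M) (q div M)"])
qed

section \<open>Decompositions at the cuts of QTT-matrices and QTT-vectors\<close>

abbreviation mat_tt_le :: "nat \<Rightarrow> nat \<Rightarrow> nat \<Rightarrow> real mat \<Rightarrow> bool" where
  "mat_tt_le m \<alpha> r \<equiv> kron_rank_le r (2 ^ \<alpha>) (2 ^ \<alpha>) (2 ^ (m - \<alpha>)) (2 ^ (m - \<alpha>))"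

abbreviation vec_tt_le :: "nat \<Rightarrow> nat \<Rightarrow> nat \<Rightarrow> real vec \<Rightarrow> bool" where
  "vec_tt_le m \<alpha> r x \<equiv> kron_rank_le r (2 ^ \<alpha>) 1 (2 ^ (m - \<alpha>)) 1 (mat_of_cols (2 ^ m) [x])"

lemma two_power_cut: "\<alpha> \<le> m \<Longrightarrow> 2 ^ \<alpha> * 2 ^ (m - \<alpha>) = (2 :: nat) ^ m"
  by (simp flip: power_add)

lemma mat_tt_rank_le_iff:
  assumes "A \<in> carrier_mat (2 ^ m) (2 ^ m)" "\<alpha> \<le> m"
  shows "mat_tt_rank m A \<alpha> \<le> r \<longleftrightarrow> mat_tt_le m \<alpha> r A"
proof -
  \<comment> \<open>A row of the unfolding carries the first \<alpha> digits of both indices, so its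
    range is the product of two equal blocks.\<close>
  have four: "(4 :: nat) ^ k = 2 ^ k * 2 ^ k" for k
    by (simp flip: power_mult_distrib)
  show ?thesis
    unfolding mat_tt_rank_def mat_unfolding_def four
    by (rule mat_rank_unfolding_le_iff) (use assms in \<open>simp add: two_power_cut\<close>)
qed

lemma vec_tt_rank_le_iff:
  assumes "x \<in> carrier_vec (2 ^ m)" "\<alpha> \<le> m"
  shows "vec_tt_rank m x \<alpha> \<le> r \<longleftrightarrow> vec_tt_le m \<alpha> r x"
proof -
  let ?A = "mat_of_cols (2 ^ m) [x]" and ?N = "2 ^ \<alpha> :: nat" and ?M = "2 ^ (m - \<alpha>) :: nat"
  \<comment> \<open>A single column has no column digits: for \<open>p < 2 ^ \<alpha>\<close> and
    \<open>q < 2 ^ (m - \<alpha>)\<close> both quotients are 0.\<close>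
  have "vec_unfolding m x \<alpha> = mat (?N * 1) (?M * 1)
      (\<lambda>(p, q). ?A $$ (p mod ?N + ?N * (q mod ?M), p div ?N + 1 * (q div ?M)))"
    unfolding vec_unfolding_def
  proof (rule eq_matI, goal_cases)
    case (1 p q)
    then have "p + ?N * q < ?N * ?M" by (intro add_mult_less_mult) auto
    then have "p + ?N * q < 2 ^ m" using assms(2) by (simp add: two_power_cut)
    then show ?case using 1 by (simp add: mat_of_cols_index)
  qed auto
  moreover have "?A \<in> carrier_mat (?N * ?M) (1 * 1)"
    using assms(2) mat_of_cols_carrier(1)[of "2 ^ m" "[x]"] by (simp add: two_power_cut)
  ultimately show ?thesis
    unfolding vec_tt_rank_def by (simp only: mat_rank_unfolding_le_iff)
qed

section \<open>Decompositions of the identity, \<open>E\<close>, \<open>B\<close> and diagonal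
  matrices\<close>

lemma mat_tt_le_one:
  assumes "\<alpha> \<le> m"
  shows "mat_tt_le m \<alpha> 1 (1\<^sub>m (2 ^ m))"
proof (rule kron_rank_leI[where P = "\<lambda>_ a a'. of_bool (a = a')" and Q = "\<lambda>_ b b'. of_bool (b = b')"])
  fix i j :: nat
  assume "i < 2 ^ \<alpha> * 2 ^ (m - \<alpha>)" "j < 2 ^ \<alpha> * 2 ^ (m - \<alpha>)"
  moreover have "i = j \<longleftrightarrow> i mod 2 ^ \<alpha> = j mod 2 ^ \<alpha> \<and> i div 2 ^ \<alpha> = j div 2 ^ \<alpha>"
    by (metis div_mult_mod_eq)
  ultimately show "(1\<^sub>m (2 ^ m) :: real mat) $$ (i, j) = (\<Sum>k<1::nat. of_bool (i mod 2 ^ \<alpha> = j mod 2 ^ \<alpha>)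
      * of_bool (i div 2 ^ \<alpha> = j div 2 ^ \<alpha>))"
    using assms by (simp add: two_power_cut)
qed (use assms in \<open>simp add: two_power_cut\<close>)

lemma mat_tt_le_E:
  assumes "\<alpha> \<le> m"
  shows "mat_tt_le m \<alpha> 1 (E_mat (2 ^ m))"
  by (rule kron_rank_leI[where P = "\<lambda>_ _ _. 1" and Q = "\<lambda>_ _ _. 1"])
    (use assms in \<open>simp_all add: two_power_cut E_mat_def\<close>)

text \<open>Indices compare lexicographically, high digits first. Term 0 covers equal high digits
  and is triangular in the low ones; term 1 covers a larger high part of the row index and is
  constant in the low digits. The mesh width sits in the low factors.\<close>

lemma mat_tt_le_B:
  assumes "\<alpha> \<le> m"
  shows "mat_tt_le m \<alpha> 2 (B_mat (2 ^ m))"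
proof (rule kron_rank_leI[where P = "\<lambda>k a a'. if k = 0 \<and> a < a' then 0 else 1 / real (2 ^ m)"
      and Q = "\<lambda>k b b'. of_bool (if k = 0 then b = b' else b > b')"])
  fix i j :: nat
  let ?N = "2 ^ \<alpha> :: nat"
  assume "i < ?N * 2 ^ (m - \<alpha>)" "j < ?N * 2 ^ (m - \<alpha>)"
  then have ij: "i < 2 ^ m" "j < 2 ^ m" using assms by (simp_all add: two_power_cut)
  have le: "a div ?N \<le> b div ?N" if "a \<le> b" for a b using that by (rule div_le_mono)
  have "i \<ge> j \<longleftrightarrow> i div ?N > j div ?N \<or> i div ?N = j div ?N \<and> i mod ?N \<ge> j mod ?N"
  proof (cases "i div ?N" "j div ?N" rule: linorder_cases)
    case equal
    then have "i \<ge> j \<longleftrightarrow> i mod ?N \<ge> j mod ?N"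
      using div_mult_mod_eq[of i ?N] div_mult_mod_eq[of j ?N] by (metis nat_add_left_cancel_le)
    then show ?thesis using equal by simp
  qed (use le[of i j] le[of j i] in linarith)+
  then show "B_mat (2 ^ m) $$ (i, j)
      = (\<Sum>k<2::nat. (if k = 0 \<and> i mod ?N < j mod ?N then 0 else 1 / real (2 ^ m))
          * of_bool (if k = 0 then i div ?N = j div ?N else i div ?N > j div ?N))"
    using ij by (auto simp: B_mat_def numeral_2_eq_2)
qed (use assms in \<open>simp add: two_power_cut B_mat_def\<close>)

text \<open>The condition \<open>i = j\<close> is a product of a mask on the low digits and one on
  the high digits, so it multiplies into each term of \<open>x\<close>.\<close>

lemma mat_tt_le_diag:
  assumes "vec_tt_le m \<alpha> r x" "x \<in> carrier_vec (2 ^ m)" "\<alpha> \<le> m"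
  shows "mat_tt_le m \<alpha> r (diag_of_vec x)"
proof -
  let ?N = "2 ^ \<alpha> :: nat"
  obtain P Q where PQ: "\<And>i j. i < ?N * 2 ^ (m - \<alpha>) \<Longrightarrow> j < 1 * 1 \<Longrightarrow>
      mat_of_cols (2 ^ m) [x] $$ (i, j) = (\<Sum>k<r. P k (i mod ?N) (j mod 1) * Q k (i div ?N) (j div 1))"
    using assms(1) by (rule kron_rank_leE) blast
  have x: "x $ i = (\<Sum>k<r. P k (i mod ?N) 0 * Q k (i div ?N) 0)" if "i < 2 ^ m" for i
    using PQ[of i 0] that assms(3) by (simp add: two_power_cut mat_of_cols_index)
  show ?thesis
  proof (rule kron_rank_leI[where P = "\<lambda>k a a'. of_bool (a = a') * P k a 0"
        and Q = "\<lambda>k b b'. of_bool (b = b') * Q k b 0"])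
    fix i j :: nat
    assume "i < ?N * 2 ^ (m - \<alpha>)" "j < ?N * 2 ^ (m - \<alpha>)"
    then have ij: "i < 2 ^ m" "j < 2 ^ m" using assms(3) by (simp_all add: two_power_cut)
    have "i = j \<longleftrightarrow> i mod ?N = j mod ?N \<and> i div ?N = j div ?N"
      by (metis div_mult_mod_eq)
    then show "diag_of_vec x $$ (i, j) = (\<Sum>k<r. of_bool (i mod ?N = j mod ?N) * P k (i mod ?N) 0
        * (of_bool (i div ?N = j div ?N) * Q k (i div ?N) 0))"
      using ij assms(2) by (auto simp: diag_of_vec_def mat_diag_def x)
  qed (use assms(2,3) in \<open>simp add: two_power_cut diag_of_vec_def\<close>)
qed

text \<open>The high block holds the remaining \<open>d - \<alpha>\<close> digits of
  \<open>A\<close> and all \<open>d\<close> digits of \<open>C\<close>.\<close>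

lemma mat_tt_le_kron_low:
  assumes "mat_tt_le d \<alpha> r A" "C \<in> carrier_mat (2 ^ d) (2 ^ d)" "\<alpha> \<le> d"
  shows "mat_tt_le (2 * d) \<alpha> r (kron C A)"
proof -
  have "2 * d - \<alpha> = (d - \<alpha>) + d" using assms(3) by simp
  then have "(2 :: nat) ^ (2 * d - \<alpha>) = 2 ^ (d - \<alpha>) * 2 ^ d" by (simp only: power_add)
  then show ?thesis using kron_rank_le_kron_low[OF assms(1,2)] by simp
qed

text \<open>The low block holds all \<open>d\<close> digits of \<open>A\<close> and the first
  \<open>\<alpha> - d\<close> digits of \<open>C\<close>.\<close>

lemma mat_tt_le_kron_high:
  assumes "mat_tt_le d (\<alpha> - d) r C" "A \<in> carrier_mat (2 ^ d) (2 ^ d)" "d \<le> \<alpha>" "\<alpha> \<le> 2 * d"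
  shows "mat_tt_le (2 * d) \<alpha> r (kron C A)"
proof -
  have "(2 :: nat) ^ \<alpha> = 2 ^ d * 2 ^ (\<alpha> - d)" using assms(3) by (simp add: two_power_cut)
  moreover have "d - (\<alpha> - d) = 2 * d - \<alpha>" using assms(3,4) by simp
  ultimately show ?thesis using kron_rank_le_kron_high[OF assms(1,2)] by simp
qed

section \<open>Maximum TT-ranks as bounds\<close>

lemma le_max_tt_rank: "\<alpha> \<in> {1..<m} \<Longrightarrow> r \<alpha> \<le> max_tt_rank m r"
  by (auto simp: max_tt_rank_def)

text \<open>This lets the rank of \<open>q\<close> absorb the single term of \<open>E\<close>. For
  \<open>m \<le> 1\<close> the convention on the empty maximum gives 1.\<close>

lemma max_vec_tt_rank_pos:
  assumes "x \<in> carrier_vec (2 ^ m)" "i < 2 ^ m" "x $ i \<noteq> 0"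
  shows "1 \<le> max_tt_rank m (vec_tt_rank m x)"
proof (cases "m \<le> 1")
  case False
  then have "1 \<le> m" by simp
  \<comment> \<open>Without terms every entry would be an empty sum, that is 0.\<close>
  have "\<not> vec_tt_le m 1 0 x"
    unfolding kron_rank_le_def two_power_cut[OF \<open>1 \<le> m\<close>]
    using assms by (auto simp: mat_of_cols_index)
  then have "1 \<le> vec_tt_rank m x 1"
    using vec_tt_rank_le_iff[of x m 1 0] assms False by simp
  also have "\<dots> \<le> max_tt_rank m (vec_tt_rank m x)"
    using False by (intro le_max_tt_rank) auto
  finally show ?thesis .
qed (simp add: max_tt_rank_def)

section \<open>The linear system\<close>

text \<open>\<open>mat_inv\<close> unwraps an option, so its size is known only once an inverse
  exists; the reciprocals of the diagonal provide one.\<close>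

lemma mat_inv_diag_carrier:
  assumes "v \<in> carrier_vec n" "\<forall>i<n. v $ i \<noteq> 0"
  shows "mat_inv (diag_of_vec v) \<in> carrier_mat n n"
proof -
  have D: "diag_of_vec v = mat_diag n (\<lambda>i. v $ i)" using assms(1) by (simp add: diag_of_vec_def)
  let ?W = "mat_diag n (\<lambda>i. inverse (v $ i))"
  have one: "mat_diag n (\<lambda>i. v $ i * inverse (v $ i)) = 1\<^sub>m n"
    "mat_diag n (\<lambda>i. inverse (v $ i) * v $ i) = 1\<^sub>m n"
    using assms(2) by (auto simp: mat_diag_def)
  have "diag_of_vec v \<in> Units (ring_mat TYPE(real) n ())"
    unfolding Units_def using one
    by (auto simp: D ring_mat_simps intro!: bexI[of _ ?W])
  then have "mat_inverse (diag_of_vec v) \<noteq> None"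
    using mat_inverse(1)[of "diag_of_vec v" n, where b = "()"] D by auto
  then obtain W where "mat_inverse (diag_of_vec v) = Some W" by auto
  then show ?thesis
    using mat_inverse(2)[of "diag_of_vec v" n W] D by (auto simp: mat_inv_def)
qed

section \<open>Cuts of the factors of \<open>Hx_mat\<close> and \<open>Hy_mat\<close>\<close>

lemma mat_tt_le_max:
  assumes "A \<in> carrier_mat (2 ^ m) (2 ^ m)" "\<alpha> \<in> {1..<m}"
  shows "mat_tt_le m \<alpha> (max_tt_rank m (mat_tt_rank m A)) A"
  using assms mat_tt_rank_le_iff[of A m \<alpha>] le_max_tt_rank[of \<alpha> m "mat_tt_rank m A"] by simp

lemma vec_tt_le_max:
  assumes "x \<in> carrier_vec (2 ^ m)" "\<alpha> \<in> {1..<m}"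
  shows "vec_tt_le m \<alpha> (max_tt_rank m (vec_tt_rank m x)) x"
  using assms vec_tt_rank_le_iff[of x m \<alpha>] le_max_tt_rank[of \<alpha> m "vec_tt_rank m x"] by simp

text \<open>Cuts up to \<open>d\<close> meet \<open>B\<close> and need two terms; later ones meet
  the identity and need one, padded to two.\<close>

lemma mat_tt_le_I_kron_B:
  assumes "\<alpha> \<le> 2 * d"
  shows "mat_tt_le (2 * d) \<alpha> 2 (Bx_mat (2 ^ d))"
proof (cases "\<alpha> \<le> d")
  case True
  then show ?thesis unfolding Bx_mat_def
    by (intro mat_tt_le_kron_low mat_tt_le_B) auto
next
  case False
  then have "mat_tt_le (2 * d) \<alpha> 1 (Bx_mat (2 ^ d))" unfolding Bx_mat_def
    using assms by (intro mat_tt_le_kron_high mat_tt_le_one) (auto simp: B_mat_def)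
  then show ?thesis by (rule kron_rank_le_mono) simp
qed

lemma mat_tt_le_B_kron_I:
  assumes "\<alpha> \<le> 2 * d"
  shows "mat_tt_le (2 * d) \<alpha> 2 (By_mat (2 ^ d))"
proof (cases "\<alpha> \<le> d")
  case True
  then have "mat_tt_le (2 * d) \<alpha> 1 (By_mat (2 ^ d))" unfolding By_mat_def
    by (intro mat_tt_le_kron_low mat_tt_le_one) (auto simp: B_mat_def)
  then show ?thesis by (rule kron_rank_le_mono) simp
next
  case False
  then show ?thesis unfolding By_mat_def
    using assms by (intro mat_tt_le_kron_high mat_tt_le_B) auto
qed

text \<open>\<open>q\<close> occupies the high modes. The cut at \<open>\<alpha> = d\<close> is
  treated as a cut of \<open>E\<close>, so that every remaining \<open>\<alpha> - d\<close> lies in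
  \<open>{1..<d}\<close>, the range of the maximum.\<close>

lemma mat_tt_le_diag_kron_E:
  assumes "q \<in> carrier_vec (2 ^ d)" "\<alpha> < 2 * d"
    and "max_tt_rank d (vec_tt_rank d q) \<le> r" "1 \<le> r"
  shows "mat_tt_le (2 * d) \<alpha> r (kron (diag_of_vec q) (E_mat (2 ^ d)))"
proof (cases "\<alpha> \<le> d")
  case True
  then have "mat_tt_le (2 * d) \<alpha> 1 (kron (diag_of_vec q) (E_mat (2 ^ d)))"
    using assms(1) by (intro mat_tt_le_kron_low mat_tt_le_E) (auto simp: diag_of_vec_def)
  then show ?thesis using assms(4) by (rule kron_rank_le_mono)
next
  case False
  have "vec_tt_le d (\<alpha> - d) r q"
    using False assms by (intro kron_rank_le_mono[OF vec_tt_le_max]) auto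
  then show ?thesis
    using False assms by (intro mat_tt_le_kron_high mat_tt_le_diag) (auto simp: E_mat_def)
qed

text \<open>\<open>q\<close> occupies the low modes. The cut at \<open>\<alpha> = d\<close> again
  goes to \<open>E\<close>, which leaves \<open>1 \<le> \<alpha> < d\<close> for
  \<open>q\<close>.\<close>

lemma mat_tt_le_E_kron_diag:
  assumes "q \<in> carrier_vec (2 ^ d)" "1 \<le> \<alpha>" "\<alpha> \<le> 2 * d"
    and "max_tt_rank d (vec_tt_rank d q) \<le> r" "1 \<le> r"
  shows "mat_tt_le (2 * d) \<alpha> r (kron (E_mat (2 ^ d)) (diag_of_vec q))"
proof (cases "d \<le> \<alpha>")
  case True
  then have "mat_tt_le (2 * d) \<alpha> 1 (kron (E_mat (2 ^ d)) (diag_of_vec q))"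
    using assms by (intro mat_tt_le_kron_high mat_tt_le_E) (auto simp: diag_of_vec_def)
  then show ?thesis using assms(5) by (rule kron_rank_le_mono)
next
  case False
  have "vec_tt_le d \<alpha> r q"
    using False assms by (intro kron_rank_le_mono[OF vec_tt_le_max]) auto
  then show ?thesis
    using False assms by (intro mat_tt_le_kron_low mat_tt_le_diag) (auto simp: E_mat_def)
qed

text \<open>The factors contribute 2 for \<open>B\<close>, \<open>k\<close> for \<open>W\<close>,
  \<open>1 + r * k\<close> for the bracket and 2 for the transpose.\<close>

lemma mat_tt_le_system:
  assumes "mat_tt_le m \<alpha> 2 B" "mat_tt_le m \<alpha> k W" "mat_tt_le m \<alpha> 1 J" "mat_tt_le m \<alpha> r L"
  shows "mat_tt_le m \<alpha> (4 * (1 + k * r) * k) (B * W * (J - L * W) * transpose_mat B)"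
proof -
  have "mat_tt_le m \<alpha> (2 * k * (1 + r * k) * 2) (B * W * (J - L * W) * transpose_mat B)"
    by (rule kron_rank_le_mult kron_rank_le_minus kron_rank_le_transpose assms)+
  moreover have "2 * k * (1 + r * k) * 2 = 4 * (1 + k * r) * k" by (simp add: algebra_simps)
  ultimately show ?thesis by simp
qed

lemma mat_tt_le_kron_one:
  assumes "\<alpha> \<le> 2 * d"
  shows "mat_tt_le (2 * d) \<alpha> 1 (kron (1\<^sub>m (2 ^ d)) (1\<^sub>m (2 ^ d)))"
proof (cases "\<alpha> \<le> d")
  case True
  then show ?thesis by (intro mat_tt_le_kron_low mat_tt_le_one) auto
next
  case False
  then show ?thesis using assms by (intro mat_tt_le_kron_high mat_tt_le_one) auto
qed

section \<open>Bounds for the system matrices and the right-hand side\<close>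

lemma mat_tt_le_Hx:
  assumes n: "n = 2 ^ d" and \<alpha>: "\<alpha> \<in> {1..<2 * d}"
    and k: "k \<in> carrier_vec (n * n)" "\<forall>\<alpha><n * n. k $ \<alpha> \<noteq> 0"
    and q: "\<forall>i<n. (\<Sum>\<alpha><n. 1 / k $ (i * n + \<alpha>)) \<noteq> 0"
  defines "r \<equiv> max_tt_rank (2 * d) (mat_tt_rank (2 * d) (mat_inv (diag_of_vec k)))"
    and "s \<equiv> max_tt_rank d (vec_tt_rank d (qx_vec n k))"
  shows "mat_tt_le (2 * d) \<alpha> (4 * (1 + r * s) * r) (Hx_mat n k)"
proof -
  have nn: "n * n = 2 ^ (2 * d)" unfolding n by (simp flip: power_add add: mult_2)
  \<comment> \<open>Entry 0 of \<open>qx_vec n k\<close> is the inverse of a nonzero sum, so this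
    vector is nonzero.\<close>
  have "1 \<le> s" unfolding s_def
    by (rule max_vec_tt_rank_pos[where i = 0]) (use q[rule_format, of 0] n in \<open>auto simp: qx_vec_def\<close>)
  then show ?thesis
    unfolding Hx_mat_def n r_def s_def
    using \<alpha> mat_inv_diag_carrier[OF k, unfolded nn]
    by (intro mat_tt_le_system mat_tt_le_I_kron_B mat_tt_le_max mat_tt_le_kron_one mat_tt_le_diag_kron_E)
      (auto simp: qx_vec_def)
qed

lemma mat_tt_le_Hy:
  assumes n: "n = 2 ^ d" and \<alpha>: "\<alpha> \<in> {1..<2 * d}"
    and k: "k \<in> carrier_vec (n * n)" "\<forall>\<alpha><n * n. k $ \<alpha> \<noteq> 0"
    and q: "\<forall>i<n. (\<Sum>\<alpha><n. 1 / k $ (i + n * \<alpha>)) \<noteq> 0"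
  defines "r \<equiv> max_tt_rank (2 * d) (mat_tt_rank (2 * d) (mat_inv (diag_of_vec k)))"
    and "s \<equiv> max_tt_rank d (vec_tt_rank d (qy_vec n k))"
  shows "mat_tt_le (2 * d) \<alpha> (4 * (1 + r * s) * r) (Hy_mat n k)"
proof -
  have nn: "n * n = 2 ^ (2 * d)" unfolding n by (simp flip: power_add add: mult_2)
  have "1 \<le> s" unfolding s_def
    by (rule max_vec_tt_rank_pos[where i = 0]) (use q[rule_format, of 0] n in \<open>auto simp: qy_vec_def\<close>)
  then show ?thesis
    unfolding Hy_mat_def n r_def s_def
    using \<alpha> mat_inv_diag_carrier[OF k, unfolded nn]
    by (intro mat_tt_le_system mat_tt_le_B_kron_I mat_tt_le_max mat_tt_le_kron_one mat_tt_le_E_kron_diag)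
      (auto simp: qy_vec_def)
qed

text \<open>Viewed as a single column, \<open>A *\<^sub>v x\<close> is a matrix product, so the
  numbers of terms multiply.\<close>

lemma vec_tt_le_mult_mat_vec:
  assumes "mat_tt_le m \<alpha> r A" "vec_tt_le m \<alpha> s x" "x \<in> carrier_vec (2 ^ m)" "\<alpha> \<le> m"
  shows "vec_tt_le m \<alpha> (r * s) (A *\<^sub>v x)"
proof -
  have A: "A \<in> carrier_mat (2 ^ m) (2 ^ m)"
    using assms(1,4) by (simp add: kron_rank_le_def two_power_cut)
  have "A * mat_of_cols (2 ^ m) [x] = mat_of_cols (2 ^ m) [A *\<^sub>v x]"
    by (rule eq_matI) (use A assms(3) in \<open>auto simp: mat_of_cols_index\<close>)
  then show ?thesis using kron_rank_le_mult[OF assms(1,2)] by simp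
qed

theorem theorem4p1:
  fixes d n :: nat
    and f k_x k_y :: "real \<Rightarrow> real \<Rightarrow> real"
    and fv kx ky :: "real vec"
    and r_kx r_ky r_qx r_qy r_f :: nat
  assumes "n = 2 ^ d"
    and "fv = f_vec n f" and "kx = kx_vec n k_x" and "ky = ky_vec n k_y"
    and "\<forall>\<alpha><n * n. kx $ \<alpha> \<noteq> 0" and "\<forall>\<alpha><n * n. ky $ \<alpha> \<noteq> 0"
    and "\<forall>i<n. (\<Sum>\<alpha><n. 1 / kx $ (i * n + \<alpha>)) \<noteq> 0"
    and "\<forall>i<n. (\<Sum>\<alpha><n. 1 / ky $ (i + n * \<alpha>)) \<noteq> 0"
    and "r_kx = max_tt_rank (2 * d) (mat_tt_rank (2 * d) (mat_inv (diag_of_vec kx)))"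
    and "r_ky = max_tt_rank (2 * d) (mat_tt_rank (2 * d) (mat_inv (diag_of_vec ky)))"
    and "r_qx = max_tt_rank d (vec_tt_rank d (qx_vec n kx))"
    and "r_qy = max_tt_rank d (vec_tt_rank d (qy_vec n ky))"
    and "r_f = max_tt_rank (2 * d) (vec_tt_rank (2 * d) fv)"
  shows "(\<forall>\<alpha>\<in>{1..<2 * d}. mat_tt_rank (2 * d) (Hx_mat n kx + Hy_mat n ky) \<alpha>
            \<le> 4 * (1 + r_kx * r_qx) * r_kx + 4 * (1 + r_ky * r_qy) * r_ky) \<and>
         (\<forall>\<alpha>\<in>{1..<2 * d}. vec_tt_rank (2 * d) (Hy_mat n ky *\<^sub>v fv) \<alpha>
            \<le> 4 * (1 + r_ky * r_qy) * r_ky * r_f)"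
proof (intro conjI ballI)
  note n = assms(1)
  have nn: "n * n = 2 ^ (2 * d)" unfolding n by (simp flip: power_add add: mult_2)
  have carrier: "kx \<in> carrier_vec (n * n)" "ky \<in> carrier_vec (n * n)" "fv \<in> carrier_vec (2 ^ (2 * d))"
    using assms(2-4) by (simp_all add: kx_vec_def ky_vec_def f_vec_def nn)
  fix \<alpha> assume \<alpha>: "\<alpha> \<in> {1..<2 * d}"
  then have "\<alpha> \<le> 2 * d" by simp
  have Hx: "mat_tt_le (2 * d) \<alpha> (4 * (1 + r_kx * r_qx) * r_kx) (Hx_mat n kx)"
    using mat_tt_le_Hx[OF n \<alpha> carrier(1) assms(5,7)] assms(9,11) by simp
  have Hy: "mat_tt_le (2 * d) \<alpha> (4 * (1 + r_ky * r_qy) * r_ky) (Hy_mat n ky)"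
    using mat_tt_le_Hy[OF n \<alpha> carrier(2) assms(6,8)] assms(10,12) by simp
  \<comment> \<open>The carrier is part of \<open>kron_rank_le\<close>, so both sizes can be read
    off from the decompositions.\<close>
  have H: "Hx_mat n kx \<in> carrier_mat (2 ^ (2 * d)) (2 ^ (2 * d))"
    "Hy_mat n ky \<in> carrier_mat (2 ^ (2 * d)) (2 ^ (2 * d))"
    using Hx Hy \<open>\<alpha> \<le> 2 * d\<close> by (simp_all add: kron_rank_le_def two_power_cut)
  show "mat_tt_rank (2 * d) (Hx_mat n kx + Hy_mat n ky) \<alpha>
      \<le> 4 * (1 + r_kx * r_qx) * r_kx + 4 * (1 + r_ky * r_qy) * r_ky"
    using kron_rank_le_add[OF Hx Hy] H \<open>\<alpha> \<le> 2 * d\<close> by (subst mat_tt_rank_le_iff) simp_all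
  have "vec_tt_le (2 * d) \<alpha> r_f fv"
    unfolding assms(13) using carrier(3) \<alpha> by (rule vec_tt_le_max)
  then have "vec_tt_le (2 * d) \<alpha> (4 * (1 + r_ky * r_qy) * r_ky * r_f) (Hy_mat n ky *\<^sub>v fv)"
    using Hy carrier(3) \<open>\<alpha> \<le> 2 * d\<close> by (intro vec_tt_le_mult_mat_vec)
  then show "vec_tt_rank (2 * d) (Hy_mat n ky *\<^sub>v fv) \<alpha> \<le> 4 * (1 + r_ky * r_qy) * r_ky * r_f"
    using H carrier(3) \<open>\<alpha> \<le> 2 * d\<close> by (subst vec_tt_rank_le_iff) simp_all
qed

end
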